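(* Let $\dot G$ be a bipartite $(2n,r)$-SR2SE with underlying graph $G$. Then: (i) $n\geqslant\binom{r}{2}+1$, and in case of equality $G$ is the incidence graph of a symmetric BIBD with parameters $(n,r,2)$; (ii) if $n$ is odd, then (a) $r$ is a perfect square, (b) $n\leqslant (n-r)^2+n-r+1$, and (c) $r(r-1)\equiv 0\pmod 4$; if $n\equiv 2\pmod 4$, then $r$ is a sum of two squares of integers.
   Context: A signed graph $\dot G=(G,\sigma)$ consists of a simple graph $G$ and $\sigma:E(G)\to\{1,-1\}$; its adjacency matrix is that of $G$ with entries of negative edges replaced by $-1$, and its eigenvalues are those of this matrix; it is bipartite if $G$ is. A signed $(0,2)$-graph is a connected signed graph in which any two distinct vertices have $0$ or $2$ common neighbours; a signed rectagraph is a triangle-free one. An SR2SE is a signed rectagraph whose spectrum consists of exactly two distinct eigenvalues $\pm\lambda$; a $(2n,r)$-SR2SE has $2n$ vertices and is $r$-regular. A symmetric BIBD with parameters $(n,r,l)$ is an arrangement of $n$ points into $n$ blocks of size $r$ such that every point lies in $r$ blocks and every pair of distinct points lies together in exactly $l$ blocks; its incidence graph has the points and blocks as vertices, a point being adjacent to a block iff it lies in it. *)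

theory Defs
  imports
    "Graph_Theory.Graph_Theory"
    "Jordan_Normal_Form.Spectral_Radius"
    "HOL-Number_Theory.Cong"
begin

text \<open>
  A simple graph is a \<open>pair_graph\<close>: a finite, loop-free digraph whose arc relation is symmetric, an
  edge \<open>uv\<close> being present as the two arcs \<open>(u, v)\<close> and \<open>(v, u)\<close>.  The signature takes the unordered
  edge \<open>{u, v}\<close>, so both arcs carry the same sign; its values off the edges are irrelevant.
\<close>

definition signed_graph :: "'a pair_pre_digraph \<Rightarrow> ('a set \<Rightarrow> int) \<Rightarrow> bool" where
  "signed_graph G \<sigma> \<longleftrightarrow> pair_graph G \<and> (\<forall>(u, v) \<in> parcs G. \<sigma> {u, v} \<in> {1, -1})"

definition signed_adj_mat :: "'a pair_pre_digraph \<Rightarrow> ('a set \<Rightarrow> int) \<Rightarrow> 'a list \<Rightarrow> real mat" where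
  "signed_adj_mat G \<sigma> vs = mat (length vs) (length vs)
     (\<lambda>(i, j). if (vs ! i, vs ! j) \<in> parcs G then of_int (\<sigma> {vs ! i, vs ! j}) else 0)"

text \<open>
  The list \<open>vs\<close> enumerates the vertices.  Lemma \<open>signed_spectrum_eq\<close> shows that the spectrum does not
  depend on the enumeration.  The matrix is real symmetric, so all its eigenvalues are real.
\<close>

definition signed_spectrum :: "'a pair_pre_digraph \<Rightarrow> ('a set \<Rightarrow> int) \<Rightarrow> real set" where
  "signed_spectrum G \<sigma> =
     spectrum (signed_adj_mat G \<sigma> (SOME vs. distinct vs \<and> set vs = pverts G))"

lemma eigenvalue_signed_adj_mat_reorder:
  assumes vs: "distinct vs" and ws: "distinct ws" and eq: "set ws = set vs"
    and ev: "eigenvalue (signed_adj_mat G \<sigma> vs) k"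
  shows "eigenvalue (signed_adj_mat G \<sigma> ws) k"
proof -
  define N where "N = length vs"
  have N: "length ws = N"
    using vs ws eq by (metis N_def distinct_card)
  define a :: "'a \<Rightarrow> 'a \<Rightarrow> real"
    where "a u v = (if (u, v) \<in> parcs G then of_int (\<sigma> {u, v}) else 0)" for u v
  have A: "signed_adj_mat G \<sigma> us = mat (length us) (length us) (\<lambda>(i, j). a (us ! i) (us ! j))" for us
    by (simp add: signed_adj_mat_def a_def)
  obtain x where x: "x \<in> carrier_vec N" "x \<noteq> 0\<^sub>v N"
    and Ax: "signed_adj_mat G \<sigma> vs *\<^sub>v x = k \<cdot>\<^sub>v x"
    using ev by (auto simp: eigenvalue_def eigenvector_def A N_def)
  have sumx: "(\<Sum>j<N. a (vs ! i) (vs ! j) * x $ j) = k * x $ i" if "i < N" for i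
  proof -
    have "(signed_adj_mat G \<sigma> vs *\<^sub>v x) $ i = (\<Sum>j<N. a (vs ! i) (vs ! j) * x $ j)"
      using that x by (simp add: A N_def scalar_prod_def atLeast0LessThan)
    then show ?thesis using that x Ax by simp
  qed
  have bv: "bij_betw ((!) vs) {..<N} (set vs)" and bw: "bij_betw ((!) ws) {..<N} (set vs)"
    using vs ws N eq by (auto intro!: bij_betw_nth simp: N_def)
  define f where "f i = inv_into {..<N} ((!) vs) (ws ! i)" for i
  have bf: "bij_betw f {..<N} {..<N}"
    using bij_betw_trans[OF bw bij_betw_inv_into[OF bv]] by (simp add: f_def[abs_def] comp_def)
  have vf: "vs ! f i = ws ! i" if "i < N" for i
  proof -
    have "ws ! i \<in> (!) vs ` {..<N}"
      using that bij_betw_imp_surj_on[OF bv] bij_betwE[OF bw] by simp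
    then show ?thesis unfolding f_def by (rule f_inv_into_f)
  qed
  have fN: "f i < N" if "i < N" for i
    using bij_betwE[OF bf] that by simp
  define y where "y = vec N (\<lambda>i. x $ f i)"
  have "y \<noteq> 0\<^sub>v N"
  proof
    assume 0: "y = 0\<^sub>v N"
    have "x $ j = 0" if "j < N" for j
    proof -
      have "j \<in> f ` {..<N}" using bij_betw_imp_surj_on[OF bf] that by simp
      then obtain i where i: "i < N" "j = f i" by auto
      then have "y $ i = x $ j" by (simp add: y_def)
      then show ?thesis using 0 i(1) by simp
    qed
    then show False using x by (auto intro!: eq_vecI)
  qed
  moreover have "signed_adj_mat G \<sigma> ws *\<^sub>v y = k \<cdot>\<^sub>v y"
  proof (rule eq_vecI)
    fix i assume "i < dim_vec (k \<cdot>\<^sub>v y)"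
    then have i: "i < N" by (simp add: y_def)
    have "(signed_adj_mat G \<sigma> ws *\<^sub>v y) $ i = (\<Sum>j<N. a (ws ! i) (ws ! j) * x $ f j)"
      using i N by (simp add: A y_def scalar_prod_def atLeast0LessThan)
    also have "\<dots> = (\<Sum>j<N. a (vs ! f i) (vs ! f j) * x $ f j)"
      using i by (intro sum.cong) (auto simp: vf)
    also have "\<dots> = (\<Sum>j<N. a (vs ! f i) (vs ! j) * x $ j)"
      using sum.reindex_bij_betw[OF bf, of "\<lambda>j. a (vs ! f i) (vs ! j) * x $ j"] by simp
    also have "\<dots> = k * x $ f i" using fN[OF i] by (rule sumx)
    finally show "(signed_adj_mat G \<sigma> ws *\<^sub>v y) $ i = (k \<cdot>\<^sub>v y) $ i"
      using i by (simp add: y_def)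
  qed (simp add: A N y_def)
  ultimately show ?thesis
    unfolding eigenvalue_def eigenvector_def by (intro exI[of _ y]) (simp add: A N y_def)
qed

lemma signed_spectrum_eq:
  assumes "distinct vs" "set vs = pverts G"
  shows "signed_spectrum G \<sigma> = spectrum (signed_adj_mat G \<sigma> vs)"
proof -
  define ws where "ws = (SOME vs. distinct vs \<and> set vs = pverts G)"
  have "distinct ws \<and> set ws = pverts G"
    unfolding ws_def by (rule someI[of _ vs]) (use assms in simp)
  then show ?thesis
    using assms eigenvalue_signed_adj_mat_reorder[of vs ws]
      eigenvalue_signed_adj_mat_reorder[of ws vs]
    unfolding signed_spectrum_def ws_def[symmetric] spectrum_def by auto
qed

definition common_neighbours :: "'a pair_pre_digraph \<Rightarrow> 'a \<Rightarrow> 'a \<Rightarrow> 'a set" where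
  "common_neighbours G u v = {w \<in> pverts G. (u, w) \<in> parcs G \<and> (v, w) \<in> parcs G}"

text \<open>\<open>Digraph_Component.connected\<close> includes that there is at least one vertex.\<close>

definition signed_02_graph :: "'a pair_pre_digraph \<Rightarrow> ('a set \<Rightarrow> int) \<Rightarrow> bool" where
  "signed_02_graph G \<sigma> \<longleftrightarrow> signed_graph G \<sigma> \<and> Digraph_Component.connected (with_proj G) \<and>
     (\<forall>u \<in> pverts G. \<forall>v \<in> pverts G. u \<noteq> v \<longrightarrow> card (common_neighbours G u v) \<in> {0, 2})"

definition triangle_free :: "'a pair_pre_digraph \<Rightarrow> bool" where
  "triangle_free G \<longleftrightarrow>
     \<not> (\<exists>u v w. (u, v) \<in> parcs G \<and> (v, w) \<in> parcs G \<and> (w, u) \<in> parcs G)"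

definition signed_rectagraph :: "'a pair_pre_digraph \<Rightarrow> ('a set \<Rightarrow> int) \<Rightarrow> bool" where
  "signed_rectagraph G \<sigma> \<longleftrightarrow> signed_02_graph G \<sigma> \<and> triangle_free G"

definition SR2SE :: "'a pair_pre_digraph \<Rightarrow> ('a set \<Rightarrow> int) \<Rightarrow> bool" where
  "SR2SE G \<sigma> \<longleftrightarrow> signed_rectagraph G \<sigma> \<and> (\<exists>\<mu>. \<mu> \<noteq> - \<mu> \<and> signed_spectrum G \<sigma> = {\<mu>, - \<mu>})"

definition regular_graph :: "'a pair_pre_digraph \<Rightarrow> nat \<Rightarrow> bool" where
  "regular_graph G r \<longleftrightarrow> (\<forall>v \<in> pverts G. out_degree (with_proj G) v = r)"

definition SR2SE_params :: "nat \<Rightarrow> nat \<Rightarrow> 'a pair_pre_digraph \<Rightarrow> ('a set \<Rightarrow> int) \<Rightarrow> bool" where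
  "SR2SE_params N r G \<sigma> \<longleftrightarrow> SR2SE G \<sigma> \<and> card (pverts G) = N \<and> regular_graph G r"

definition bipartite_graph :: "'a pair_pre_digraph \<Rightarrow> bool" where
  "bipartite_graph G \<longleftrightarrow>
     (\<exists>U W. pverts G = U \<union> W \<and> U \<inter> W = {} \<and> parcs G \<subseteq> U \<times> W \<union> W \<times> U)"

text \<open>
  The blocks form a family \<open>blk\<close> indexed by \<open>B\<close>, so that blocks with different indices may contain
  the same points.  This is needed for the parameters \<open>(2, 2, 2)\<close>, where both blocks consist of both
  points and the incidence graph is the 4-cycle.
\<close>

definition symmetric_BIBD ::
  "'p set \<Rightarrow> 'b set \<Rightarrow> ('b \<Rightarrow> 'p set) \<Rightarrow> nat \<Rightarrow> nat \<Rightarrow> nat \<Rightarrow> bool" where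
  "symmetric_BIBD P B blk n r l \<longleftrightarrow>
     finite P \<and> card P = n \<and> finite B \<and> card B = n \<and>
     (\<forall>b \<in> B. blk b \<subseteq> P \<and> card (blk b) = r) \<and>
     (\<forall>p \<in> P. card {b \<in> B. p \<in> blk b} = r) \<and>
     (\<forall>p \<in> P. \<forall>q \<in> P. p \<noteq> q \<longrightarrow> card {b \<in> B. p \<in> blk b \<and> q \<in> blk b} = l)"

definition incidence_graph :: "'p set \<Rightarrow> 'b set \<Rightarrow> ('b \<Rightarrow> 'p set) \<Rightarrow> ('p + 'b) pair_pre_digraph" where
  "incidence_graph P B blk =
     \<lparr> pverts = Inl ` P \<union> Inr ` B,
       parcs = {(Inl p, Inr b) | p b. p \<in> P \<and> b \<in> B \<and> p \<in> blk b} \<union>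
               {(Inr b, Inl p) | p b. p \<in> P \<and> b \<in> B \<and> p \<in> blk b} \<rparr>"

end

theory Submission
  imports Defs
begin

text \<open>
  A symmetric matrix with eigenvalues \<open>\<plusminus>\<mu>\<close> squares to \<open>\<mu>\<^sup>2\<close>, and the diagonal of the square of the signed
  adjacency matrix shows \<open>\<mu>\<^sup>2 = r\<close>.  So the signed biadjacency matrix \<open>M\<close> is a weighing matrix:
  an \<open>n \<times> n\<close> integer matrix with \<open>M\<^sup>T * M = r\<close>.

  The pairs of neighbours of a vertex \<open>u\<close> correspond to the vertices at distance two from \<open>u\<close>, which
  lie in the same part as \<open>u\<close>; this gives \<open>n \<ge> (r choose 2) + 1\<close>, and in case of equality any two
  vertices of a part have two common neighbours.

  If \<open>n\<close> is odd, then \<open>r ^ n = (det M)\<^sup>2\<close> forces \<open>r\<close> to be a square; the other two claims are then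
  arithmetic.  If \<open>n = 4 * m + 2\<close>, the argument is that of Bruck and Ryser: the identity
  \<open>(\<Sum>i. (M x)\<^sub>i\<^sup>2) = r * (\<Sum>j. x\<^sub>j\<^sup>2)\<close> is combined with a representation of \<open>r\<close> as a sum of four rational
  squares, which turns \<open>4 * m\<close> of the squares on the right into squares of new variables; these cancel
  against as many squares on the left and leave \<open>r\<close> as a sum of two rational squares.
\<close>

subsection \<open>Symmetric matrices with two eigenvalues\<close>

definition mat_trace :: "'a :: comm_ring_1 mat \<Rightarrow> 'a" where
  "mat_trace A = (\<Sum>i<dim_row A. A $$ (i, i))"

lemma mat_trace_mult:
  assumes "A \<in> carrier_mat n n" "B \<in> carrier_mat n n"
  shows "mat_trace (A * B) = (\<Sum>i<n. \<Sum>j<n. A $$ (i, j) * B $$ (j, i))"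
  using assms by (simp add: mat_trace_def scalar_prod_def atLeast0LessThan)

lemma mat_trace_mult_commute:
  assumes "A \<in> carrier_mat n n" "B \<in> carrier_mat n n"
  shows "mat_trace (A * B) = mat_trace (B * A)"
  unfolding mat_trace_mult[OF assms] mat_trace_mult[OF assms(2,1)]
  by (subst sum.swap) (simp add: mult.commute)

text \<open>By symmetry the Hermitian form \<open>s\<close> of an eigenvector is its own conjugate;
  it equals \<open>e\<close> times the nonzero squared norm \<open>N\<close>, so \<open>e\<close> is
  real.\<close>

lemma eigenvalue_complex_of_real_symmetric:
  fixes A :: "real mat"
  assumes A: "A \<in> carrier_mat n n" and sym: "\<And>i j. i < n \<Longrightarrow> j < n \<Longrightarrow> A $$ (i, j) = A $$ (j, i)"
    and ev: "eigenvalue (map_mat complex_of_real A) e"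
  shows "\<exists>k. e = of_real k \<and> eigenvalue A k"
proof -
  let ?A = "map_mat complex_of_real A"
  have cA: "?A \<in> carrier_mat n n" using A by simp
  obtain v where v: "v \<in> carrier_vec n" "v \<noteq> 0\<^sub>v n" and Av: "?A *\<^sub>v v = e \<cdot>\<^sub>v v"
    using ev cA unfolding eigenvalue_def eigenvector_def by auto
  define N where "N = (\<Sum>i<n. (cmod (v $ i))\<^sup>2)"
  define s where "s = (\<Sum>i<n. cnj (v $ i) * (\<Sum>j<n. of_real (A $$ (i, j)) * v $ j))"
  have "(\<Sum>j<n. of_real (A $$ (i, j)) * v $ j) = e * v $ i" if "i < n" for i
  proof -
    have "(?A *\<^sub>v v) $ i = (\<Sum>j<n. of_real (A $$ (i, j)) * v $ j)"
      using that A v by (simp add: scalar_prod_def atLeast0LessThan)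
    then show ?thesis using Av that v by simp
  qed
  then have "s = (\<Sum>i<n. e * (v $ i * cnj (v $ i)))"
    unfolding s_def by (intro sum.cong refl) (simp add: algebra_simps)
  then have s: "s = e * of_real N"
    by (simp only: N_def sum_distrib_left complex_norm_square of_real_sum)
  have "cnj s = (\<Sum>i<n. \<Sum>j<n. of_real (A $$ (j, i)) * v $ i * cnj (v $ j))"
    unfolding s_def using sym by (simp add: sum_distrib_left algebra_simps)
  also have "\<dots> = s"
    unfolding s_def by (subst sum.swap) (simp add: sum_distrib_left algebra_simps)
  finally have "cnj s = s" .
  moreover have "N \<noteq> 0"
  proof
    assume "N = 0"
    then have "\<And>i. i < n \<Longrightarrow> v $ i = 0" by (simp add: N_def sum_nonneg_eq_0_iff)
    then show False using v by (auto intro: eq_vecI)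
  qed
  ultimately have "cnj e = e" using s by simp
  then obtain k where k: "e = of_real k" by (auto simp: complex_eq_iff intro: that[of "Re e"])
  \<comment> \<open>The eigenvector \<open>v\<close> may be complex, so the eigenvalue is brought
    back to \<open>A\<close> through the characteristic polynomial.\<close>
  have "of_real (poly (char_poly A) k) = poly (char_poly ?A) e"
    unfolding k of_real_hom.char_poly_hom[OF A] by simp
  also have "\<dots> = 0" using ev eigenvalue_root_char_poly[OF cA] by simp
  finally show ?thesis using eigenvalue_root_char_poly[OF A] k by auto
qed

text \<open>
  Over the complex numbers \<open>A\<^sup>2 - c\<close> is similar to a strictly upper triangular matrix, so the
  trace of its square vanishes; this trace is the sum of the squares of the entries of \<open>A\<^sup>2 - c\<close>.
\<close>

lemma real_symmetric_eigenvalues_imp_square: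
  fixes A :: "real mat"
  assumes A: "A \<in> carrier_mat n n" and sym: "\<And>i j. i < n \<Longrightarrow> j < n \<Longrightarrow> A $$ (i, j) = A $$ (j, i)"
    and ev: "\<And>k. eigenvalue A k \<Longrightarrow> k\<^sup>2 = c"
  shows "A * A = c \<cdot>\<^sub>m 1\<^sub>m n"
proof -
  let ?A = "map_mat complex_of_real A" and ?c = "complex_of_real c"
  have cA: "?A \<in> carrier_mat n n" using A by simp
  obtain es where es: "char_poly ?A = (\<Prod>a\<leftarrow>es. [:- a, 1:])"
    using char_poly_factorized[OF cA] by blast
  obtain T P Q where "schur_decomposition ?A es = (T, P, Q)" by (metis prod_cases3)
  note schur = schur_decomposition[OF cA es this]
  have carr: "T \<in> carrier_mat n n" "P \<in> carrier_mat n n" "Q \<in> carrier_mat n n"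
    and PQ: "P * Q = 1\<^sub>m n" "Q * P = 1\<^sub>m n" and APQ: "?A = P * T * Q"
    using similar_mat_witD2[OF cA] schur by auto
  have T0: "T $$ (i, j) = 0" if "j < i" "i < n" for i j
    using schur carr that by auto
  have Td: "T $$ (i, i) * T $$ (i, i) = ?c" if "i < n" for i
  proof -
    have "T $$ (i, i) \<in> set es"
      using schur that carr by (auto simp: diag_mat_def)
    then have "poly (char_poly ?A) (T $$ (i, i)) = 0"
      unfolding es by (auto simp: poly_prod_list prod_list_zero_iff)
    then have "eigenvalue ?A (T $$ (i, i))" using eigenvalue_root_char_poly[OF cA] by simp
    then obtain k where "T $$ (i, i) = of_real k" "eigenvalue A k"
      using eigenvalue_complex_of_real_symmetric[OF A sym] by blast
    then show ?thesis using ev by (metis of_real_mult power2_eq_square)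
  qed
  define S where "S = T * T - ?c \<cdot>\<^sub>m 1\<^sub>m n"
  have cS: "S \<in> carrier_mat n n" using carr by (simp add: S_def minus_carrier_mat)
  have S0: "S $$ (i, j) = 0" if "j \<le> i" "i < n" for i j
  proof -
    \<comment> \<open>Row \<open>i\<close> of \<open>T\<close> vanishes left of column
      \<open>i\<close>, and column \<open>j\<close> vanishes below row \<open>j\<close>, where
      \<open>j \<le> i\<close>; so only \<open>k = i\<close> can contribute.\<close>
    have "(\<Sum>k<n. T $$ (i, k) * T $$ (k, j)) = (\<Sum>k<n. if k = i then T $$ (i, i) * T $$ (i, j) else 0)"
      using that T0 by (intro sum.cong refl) (auto simp: not_less_iff_gr_or_eq nat_neq_iff)
    then have "(T * T) $$ (i, j) = T $$ (i, i) * T $$ (i, j)"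
      using that carr by (simp add: scalar_prod_def atLeast0LessThan)
    then show ?thesis using that carr T0 Td by (auto simp: S_def le_less)
  qed
  define D where "D = A * A - c \<cdot>\<^sub>m 1\<^sub>m n"
  have cD: "D \<in> carrier_mat n n" using A by (simp add: D_def minus_carrier_mat)
  let ?D = "map_mat complex_of_real D"
  have cD': "?D \<in> carrier_mat n n" using cD by simp
  have "P * (T * T) * Q = (P * T * Q) * (P * T * Q)"
  proof -
    have "(P * T * Q) * (P * T * Q) = P * T * (Q * P) * T * Q"
      using carr by (simp add: assoc_mult_mat[of _ n n _ n _ n])
    then show ?thesis using carr by (simp add: PQ assoc_mult_mat[of _ n n _ n _ n])
  qed
  then have "P * S * Q = ?A * ?A - ?c \<cdot>\<^sub>m 1\<^sub>m n"
    using carr by (simp add: S_def APQ mult_minus_distrib_mat[of _ n n _ n]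
      minus_mult_distrib_mat[of _ n n _ _ n] mult_smult_distrib[of _ n n _ n] mult_smult_assoc_mat[of _ n n _ n] PQ)
  also have "\<dots> = ?D"
    using A by (intro eq_matI) (simp_all add: D_def scalar_prod_def)
  finally have D: "?D = P * S * Q" ..
  have "?D * ?D = P * (S * S) * Q"
  proof -
    have "(P * S * Q) * (P * S * Q) = P * S * (Q * P) * S * Q"
      using carr cS by (simp add: assoc_mult_mat[of _ n n _ n _ n])
    then show ?thesis using carr cS by (simp add: D PQ assoc_mult_mat[of _ n n _ n _ n])
  qed
  then have "mat_trace (?D * ?D) = mat_trace (Q * (P * (S * S)))"
    using carr cS by (simp add: mat_trace_mult_commute[of _ n])
  also have "Q * (P * (S * S)) = S * S"
    using carr cS assoc_mult_mat[of Q n n P n "S * S" n] by (simp add: PQ)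
  \<comment> \<open>Of the entries of \<open>S\<close> at \<open>(i, j)\<close> and
    \<open>(j, i)\<close>, at least one is on or below the diagonal.\<close>
  also have "mat_trace (S * S) = 0"
    unfolding mat_trace_mult[OF cS cS]
    by (intro sum.neutral ballI) (metis S0 lessThan_iff mult_eq_0_iff nat_le_linear)
  finally have "0 = (\<Sum>i<n. \<Sum>j<n. ?D $$ (i, j) * ?D $$ (j, i))"
    unfolding mat_trace_mult[OF cD' cD'] by simp
  also have "\<dots> = of_real (\<Sum>i<n. \<Sum>j<n. (D $$ (i, j))\<^sup>2)"
  proof -
    have "D $$ (j, i) = D $$ (i, j)" if "i < n" "j < n" for i j
      using that A sym by (auto simp: D_def scalar_prod_def mult.commute intro!: sum.cong)
    then show ?thesis
      using cD unfolding of_real_sum by (intro sum.cong refl) (simp add: power2_eq_square)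
  qed
  finally have "(\<Sum>i<n. \<Sum>j<n. (D $$ (i, j))\<^sup>2) = 0" by (metis of_real_eq_0_iff)
  then have "D $$ (i, j) = 0" if "i < n" "j < n" for i j
    using that by (simp add: sum_nonneg_eq_0_iff sum_nonneg)
  then have "(A * A) $$ (i, j) = (c \<cdot>\<^sub>m 1\<^sub>m n) $$ (i, j)" if "i < n" "j < n" for i j
    using that A by (auto simp: D_def)
  then show ?thesis using A by (intro eq_matI) auto
qed

subsection \<open>Sums of two and four squares\<close>

lemma nearest_multiple:
  fixes x t :: int
  assumes "t > 0"
  obtains y where "2 * \<bar>x - t * y\<bar> \<le> t"
proof
  \<comment> \<open>This is the floor of \<open>x / t + 1 / 2\<close>, that is, \<open>x / t\<close>
    rounded to a nearest integer.\<close>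
  define q where "q = (2 * x + t) div (2 * t)"
  have "2 * t * q + (2 * x + t) mod (2 * t) = 2 * x + t"
    unfolding q_def by (rule mult_div_mod_eq)
  moreover have "0 \<le> (2 * x + t) mod (2 * t)" "(2 * x + t) mod (2 * t) < 2 * t"
    using assms by simp_all
  ultimately show "2 * \<bar>x - t * q\<bar> \<le> t"
    by (simp add: abs_if algebra_simps)
qed

text \<open>
  Davenport--Cassels descent: the line through the rational point \<open>(x\<^sub>1, x\<^sub>2) / t\<close> of the circle of
  radius \<open>\<surd>r\<close> and the nearest lattice point \<open>(y\<^sub>1, y\<^sub>2)\<close> meets the circle in a second point, whose
  denominator \<open>t'\<close> is at most \<open>t / 2\<close>.
\<close>

lemma sum_two_squares_of_square_mult:
  fixes r t x\<^sub>1 x\<^sub>2 :: int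
  assumes "t > 0" and "t\<^sup>2 * r = x\<^sub>1\<^sup>2 + x\<^sub>2\<^sup>2"
  shows "\<exists>a b :: int. r = a\<^sup>2 + b\<^sup>2"
  using assms
proof (induction "nat t" arbitrary: t x\<^sub>1 x\<^sub>2 rule: less_induct)
  case less
  obtain y\<^sub>1 where y1: "2 * \<bar>x\<^sub>1 - t * y\<^sub>1\<bar> \<le> t" using nearest_multiple less.prems by blast
  obtain y\<^sub>2 where y2: "2 * \<bar>x\<^sub>2 - t * y\<^sub>2\<bar> \<le> t" using nearest_multiple less.prems by blast
  \<comment> \<open>The second intersection point has coordinates
    \<open>(a * x + b * y) / t'\<close>; the weights \<open>a * t\<close> and \<open>b\<close> of
    the two given points add up to \<open>t'\<close>.\<close>
  define a where "a = y\<^sub>1\<^sup>2 + y\<^sub>2\<^sup>2 - r"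
  define b where "b = 2 * (r * t - (x\<^sub>1 * y\<^sub>1 + x\<^sub>2 * y\<^sub>2))"
  define t' where "t' = a * t + b"
  \<comment> \<open>Hence \<open>t' / t\<close> is the squared distance of the two given points, at
    most \<open>1/4 + 1/4\<close>, and \<open>t' = 0\<close> means that they coincide.\<close>
  have tt: "t * t' = (x\<^sub>1 - t * y\<^sub>1)\<^sup>2 + (x\<^sub>2 - t * y\<^sub>2)\<^sup>2"
  proof -
    have "t * t' = t\<^sup>2 * (y\<^sub>1\<^sup>2 + y\<^sub>2\<^sup>2) - 2 * t * (x\<^sub>1 * y\<^sub>1 + x\<^sub>2 * y\<^sub>2) + t\<^sup>2 * r"
      by (simp add: t'_def a_def b_def algebra_simps power2_eq_square)
    then show ?thesis
      unfolding less.prems(2) by (simp add: algebra_simps power2_eq_square)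
  qed
  have norm: "t'\<^sup>2 * r = (a * x\<^sub>1 + b * y\<^sub>1)\<^sup>2 + (a * x\<^sub>2 + b * y\<^sub>2)\<^sup>2"
  proof -
    have P: "2 * (x\<^sub>1 * y\<^sub>1 + x\<^sub>2 * y\<^sub>2) = 2 * r * t - b" and Y: "y\<^sub>1\<^sup>2 + y\<^sub>2\<^sup>2 = a + r"
      by (simp_all add: a_def b_def)
    have "(a * x\<^sub>1 + b * y\<^sub>1)\<^sup>2 + (a * x\<^sub>2 + b * y\<^sub>2)\<^sup>2 =
        a\<^sup>2 * (x\<^sub>1\<^sup>2 + x\<^sub>2\<^sup>2) + a * b * (2 * (x\<^sub>1 * y\<^sub>1 + x\<^sub>2 * y\<^sub>2)) + b\<^sup>2 * (y\<^sub>1\<^sup>2 + y\<^sub>2\<^sup>2)"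
      by (simp add: algebra_simps power2_eq_square)
    also have "\<dots> = t'\<^sup>2 * r"
      unfolding less.prems(2)[symmetric] P Y t'_def by (simp add: algebra_simps power2_eq_square)
    finally show ?thesis ..
  qed
  have sq: "4 * (x\<^sub>1 - t * y\<^sub>1)\<^sup>2 \<le> t\<^sup>2" "4 * (x\<^sub>2 - t * y\<^sub>2)\<^sup>2 \<le> t\<^sup>2"
    using power_mono[OF y1, of 2] power_mono[OF y2, of 2] by (simp_all add: power_mult_distrib)
  have "t * t' \<ge> 0" by (simp add: tt)
  then have t': "t' \<ge> 0" using less.prems(1) by (simp add: zero_le_mult_iff)
  show ?case
  proof (cases "t' = 0")
    case True
    then have "x\<^sub>1 = t * y\<^sub>1" "x\<^sub>2 = t * y\<^sub>2"
      using tt by (simp_all add: sum_power2_eq_zero_iff)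
    then have "t\<^sup>2 * r = t\<^sup>2 * (y\<^sub>1\<^sup>2 + y\<^sub>2\<^sup>2)"
      using less.prems(2) by (simp add: power_mult_distrib algebra_simps)
    then show ?thesis using less.prems(1) by auto
  next
    case False
    have "4 * (t * t') \<le> 2 * (t * t)" using sq tt by (simp add: power2_eq_square)
    then have "t * (2 * t') \<le> t * t" by linarith
    then have "2 * t' \<le> t" using less.prems(1) by (simp add: mult_le_cancel_left_pos)
    then show ?thesis using less.hyps[of t'] norm t' False by simp
  qed
qed

lemma sum_two_squares_rat_imp_int:
  fixes r :: int and a b :: rat
  assumes "of_int r = a\<^sup>2 + b\<^sup>2"
  shows "\<exists>a b :: int. r = a\<^sup>2 + b\<^sup>2"
proof -
  obtain p q where a: "a = of_int p / of_int q" "q > 0"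
    by (cases a) (auto simp: Fract_of_int_quotient)
  obtain s t where b: "b = of_int s / of_int t" "t > 0"
    by (cases b) (auto simp: Fract_of_int_quotient)
  have "(of_int ((q * t)\<^sup>2 * r) :: rat) = of_int ((p * t)\<^sup>2 + (s * q)\<^sup>2)"
    using assms a b by (simp add: field_simps power2_eq_square)
  then have "(q * t)\<^sup>2 * r = (p * t)\<^sup>2 + (s * q)\<^sup>2" by (simp only: of_int_eq_iff)
  then show ?thesis
    using sum_two_squares_of_square_mult[of "q * t" r "p * t" "s * q"] a(2) b(2) by simp
qed

section \<open>Sums of four squares over the rationals\<close>

definition sum_four_rat_squares :: "rat \<Rightarrow> bool" where
  "sum_four_rat_squares x \<longleftrightarrow> (\<exists>a b c d. x = a\<^sup>2 + b\<^sup>2 + c\<^sup>2 + d\<^sup>2)"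

lemma sum_four_rat_squaresI: "x = a\<^sup>2 + b\<^sup>2 + c\<^sup>2 + d\<^sup>2 \<Longrightarrow> sum_four_rat_squares x"
  unfolding sum_four_rat_squares_def by blast

text \<open>Euler's four-square identity: the witnesses are the coordinates of the second quaternion
  times the conjugate of the first.\<close>

lemma sum_four_rat_squares_mult:
  assumes "sum_four_rat_squares x" "sum_four_rat_squares y"
  shows "sum_four_rat_squares (x * y)"
proof -
  obtain a b c d where x: "x = a\<^sup>2 + b\<^sup>2 + c\<^sup>2 + d\<^sup>2"
    using assms(1) by (auto simp: sum_four_rat_squares_def)
  obtain p q r s where y: "y = p\<^sup>2 + q\<^sup>2 + r\<^sup>2 + s\<^sup>2"
    using assms(2) by (auto simp: sum_four_rat_squares_def)
  show ?thesis
    by (rule sum_four_rat_squaresI[of _ "a*p + b*q + c*r + d*s" "a*q - b*p + c*s - d*r"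
          "a*r - b*s - c*p + d*q" "a*s + b*r - c*q - d*p"])
      (simp add: x y power2_eq_square algebra_simps)
qed

text \<open>Since \<open>x = (x * y) * y * (1 / y)^2\<close>, division reduces to multiplication;
  this is the gain from allowing rational squares.\<close>

lemma sum_four_rat_squares_divide:
  assumes "sum_four_rat_squares (x * y)" "sum_four_rat_squares y" "y \<noteq> 0"
  shows "sum_four_rat_squares x"
proof -
  have "sum_four_rat_squares ((1 / y)\<^sup>2)"
    by (rule sum_four_rat_squaresI[of _ "1 / y" 0 0 0]) simp
  with assms have "sum_four_rat_squares ((x * y) * y * (1 / y)\<^sup>2)"
    by (blast intro: sum_four_rat_squares_mult)
  moreover have "(x * y) * y * (1 / y)\<^sup>2 = x"
    using assms(3) by (simp add: power2_eq_square)
  ultimately show ?thesis by (simp only:)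
qed

text \<open>If \<open>p\<close> divides \<open>(x - y) * (x + y)\<close>, it divides a factor, and
  both factors are smaller than \<open>p\<close> in absolute value.\<close>

lemma prime_square_inj_on:
  fixes h p :: nat
  assumes p: "prime p" and h: "2 * h < p"
  shows "inj_on (\<lambda>x. int x ^ 2 mod int p) {..h}"
proof (rule inj_onI)
  fix x y assume xy: "x \<in> {..h}" "y \<in> {..h}" and eq: "int x ^ 2 mod int p = int y ^ 2 mod int p"
  have "int p dvd int x ^ 2 - int y ^ 2"
    using eq by (simp add: mod_eq_dvd_iff)
  then have "int p dvd (int x - int y) * (int x + int y)"
    by (simp add: power2_eq_square algebra_simps)
  then have "int p dvd int x - int y \<or> int p dvd int x + int y"
    using p by (simp add: prime_dvd_mult_iff)
  then show "x = y"
  proof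
    assume "int p dvd int x - int y"
    then show ?thesis using xy h dvd_imp_le_int[of "int x - int y" "int p"] by fastforce
  next
    assume "int p dvd int x + int y"
    then show ?thesis using xy h dvd_imp_le_int[of "int x + int y" "int p"] by fastforce
  qed
qed

text \<open>Pigeonhole: for \<open>p = 2 * h + 1\<close> there are \<open>h + 1\<close> residues
  \<open>x^2\<close> and \<open>h + 1\<close> residues \<open>- 1 - y^2\<close>, so two of them
  agree.\<close>

lemma prime_dvd_sum_squares_plus_one:
  assumes p: "prime (p :: nat)"
  shows "\<exists>x y m :: nat. 0 < m \<and> m < p \<and> p * m = x\<^sup>2 + y\<^sup>2 + 1"
proof (cases "p = 2")
  case True
  then have "0 < (1::nat) \<and> 1 < p \<and> p * 1 = 1\<^sup>2 + 0\<^sup>2 + 1" by simp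
  then show ?thesis by blast
next
  case False
  then have "odd p" using p prime_odd_nat prime_ge_2_nat[OF p] by simp
  then obtain h where h: "p = 2 * h + 1" by (elim oddE)
  have p1: "p > 1" using p by (rule prime_gt_1_nat)
  let ?f = "\<lambda>x. int x ^ 2 mod int p" and ?g = "\<lambda>x. (- 1 - int x ^ 2) mod int p"
  have inj: "inj_on ?f {..h}" using prime_square_inj_on[OF p] h by simp
  have "inj_on ?g {..h}"
  proof (rule inj_onI)
    fix x y assume "x \<in> {..h}" "y \<in> {..h}" "?g x = ?g y"
    moreover from this have "?f x = ?f y"
      by (simp add: mod_eq_dvd_iff dvd_diff_commute)
    ultimately show "x = y" by (intro inj_onD[OF inj])
  qed
  then have c: "card (?f ` {..h}) = h + 1" "card (?g ` {..h}) = h + 1"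
    using inj by (simp_all add: card_image)
  have "?f ` {..h} \<inter> ?g ` {..h} \<noteq> {}"
  proof
    assume "?f ` {..h} \<inter> ?g ` {..h} = {}"
    then have "card (?f ` {..h} \<union> ?g ` {..h}) = 2 * h + 2"
      using c by (simp add: card_Un_disjoint)
    moreover have "?f ` {..h} \<union> ?g ` {..h} \<subseteq> {0..<int p}" using p1 by auto
    then have "card (?f ` {..h} \<union> ?g ` {..h}) \<le> card {0..<int p}"
      by (rule card_mono[rotated]) simp
    ultimately show False using h by simp
  qed
  then obtain x y where xy: "x \<le> h" "y \<le> h" "?f x = ?g y" by auto
  then have "int p dvd int (x\<^sup>2 + y\<^sup>2 + 1)" by (simp add: mod_eq_dvd_iff algebra_simps)
  then have "p dvd x\<^sup>2 + y\<^sup>2 + 1" by (simp only: int_dvd_int_iff)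
  then obtain m where m: "x\<^sup>2 + y\<^sup>2 + 1 = p * m" by (elim dvdE)
  \<comment> \<open>Taking \<open>x\<close> and \<open>y\<close> below \<open>p / 2\<close> is what
    makes the cofactor \<open>m\<close> smaller than \<open>p\<close>.\<close>
  have "x\<^sup>2 \<le> h\<^sup>2" "y\<^sup>2 \<le> h\<^sup>2" using xy by (auto intro: power_mono)
  then have "p * m \<le> 2 * h\<^sup>2 + 1" using m by linarith
  also have "\<dots> < p * p" using h p1 by (simp add: power2_eq_square algebra_simps)
  finally have "m < p" by simp
  moreover have "m > 0" using m by (cases m) auto
  ultimately show ?thesis using m by metis
qed

text \<open>
  For a prime \<open>p\<close>, some \<open>p * m\<close> with \<open>0 < m < p\<close> is a sum of squares; since \<open>m\<close> is inductively a sum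
  of four rational squares, so is the quotient \<open>p\<close>, and no descent is needed.
\<close>

lemma sum_four_rat_squares_of_nat: "sum_four_rat_squares (of_nat n)"
proof (induction n rule: less_induct)
  case (less n)
  consider "n = 0" | "n = 1" | "prime n" | "n > 1" "\<not> prime n" by fastforce
  then show ?case
  proof cases
    case 1 then show ?thesis by (intro sum_four_rat_squaresI[of _ 0 0 0 0]) simp
  next
    case 2 then show ?thesis by (intro sum_four_rat_squaresI[of _ 1 0 0 0]) simp
  next
    case 3
    then obtain x y m where m: "0 < m" "m < n" "n * m = x\<^sup>2 + y\<^sup>2 + 1"
      using prime_dvd_sum_squares_plus_one by blast
    have "of_nat n * of_nat m = (of_nat (x\<^sup>2 + y\<^sup>2 + 1) :: rat)"
      unfolding m(3)[symmetric] by simp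
    then have "sum_four_rat_squares (of_nat n * of_nat m)"
      by (intro sum_four_rat_squaresI[of _ "of_nat x" "of_nat y" 1 0]) simp
    then show ?thesis
      using less.IH[OF m(2)] m(1) by (auto intro: sum_four_rat_squares_divide)
  next
    case 4
    then obtain a b where ab: "n = a * b" "a \<noteq> 1" "a \<noteq> n"
      unfolding prime_nat_iff by (auto elim: dvdE)
    then have "a > 0" "b > 0" "b \<noteq> 1" using 4 by auto
    then have "a < n" "b < n" using ab by auto
    then show ?thesis using sum_four_rat_squares_mult[OF less.IH less.IH] ab by simp
  qed
qed

subsection \<open>Weighing matrices\<close>

text \<open>
  The unknowns are eliminated one at a time: an affine function of \<open>z k\<close> agrees with \<open>z k\<close> or with
  \<open>- z k\<close> for some \<open>z k\<close>, since its slope differs from \<open>1\<close> or from \<open>- 1\<close>.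
\<close>

lemma affine_system_up_to_sign:
  fixes A :: "nat \<Rightarrow> nat \<Rightarrow> rat" and c :: "nat \<Rightarrow> rat"
  shows "\<exists>z. \<forall>i<k. (c i + (\<Sum>j<k. A i j * z j))\<^sup>2 = (z i)\<^sup>2"
proof (induction k arbitrary: A c)
  case (Suc k)
  define e :: rat where "e = (if A k k = 1 then - 1 else 1)"
  define d where "d = e - A k k"
  have d: "d \<noteq> 0" and e: "e\<^sup>2 = 1" by (auto simp: e_def d_def)
  \<comment> \<open>Setting the last form equal to \<open>e\<close> times the last unknown gives
    \<open>(c k + s) / d\<close> for it; substituting this leaves \<open>k\<close> equations in
    \<open>k\<close> unknowns.\<close>
  obtain z where z: "\<forall>i<k. (c i + A i k * (c k / d) +
      (\<Sum>j<k. (A i j + A i k * (A k j / d)) * z j))\<^sup>2 = (z i)\<^sup>2"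
    using Suc.IH[of "\<lambda>i. c i + A i k * (c k / d)" "\<lambda>i j. A i j + A i k * (A k j / d)"] by blast
  define s where "s = (\<Sum>j<k. A k j * z j)"
  define w where "w = z(k := (c k + s) / d)"
  have w: "(\<Sum>j<Suc k. A i j * w j) = (\<Sum>j<k. A i j * z j) + A i k * ((c k + s) / d)" for i
    by (simp add: w_def)
  have "(c i + (\<Sum>j<Suc k. A i j * w j))\<^sup>2 = (w i)\<^sup>2" if "i < Suc k" for i
  proof (cases "i = k")
    case True
    have "c k + (\<Sum>j<Suc k. A k j * w j) = e * ((c k + s) / d)"
      unfolding w s_def[symmetric] using d by (simp add: d_def field_simps)
    then show ?thesis using True e by (simp add: w_def power_mult_distrib power_divide)
  next
    case False
    have "(\<Sum>j<k. (A i j + A i k * (A k j / d)) * z j) = (\<Sum>j<k. A i j * z j) + A i k * (s / d)"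
      by (simp add: s_def algebra_simps sum.distrib sum_distrib_left sum_divide_distrib)
    then have "c i + (\<Sum>j<Suc k. A i j * w j) =
        c i + A i k * (c k / d) + (\<Sum>j<k. (A i j + A i k * (A k j / d)) * z j)"
      unfolding w by (simp add: algebra_simps add_divide_distrib)
    moreover have "w i = z i" "i < k" using that False by (simp_all add: w_def)
    ultimately show ?thesis using z by (simp only: add.assoc)
  qed
  then show ?case by blast
qed simp

text \<open>A predicate on functions: closure under sums and multiples shows that a composed
  expression is affine without computing its coefficients.\<close>

definition affine_form :: "nat \<Rightarrow> ((nat \<Rightarrow> rat) \<Rightarrow> rat) \<Rightarrow> bool" where
  "affine_form k f \<longleftrightarrow> (\<exists>c a. \<forall>z. f z = c + (\<Sum>j<k. a j * z j))"

lemma affine_form_const: "affine_form k (\<lambda>z. c)"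
  unfolding affine_form_def by (rule exI[of _ c], rule exI[of _ "\<lambda>_. 0"]) simp

lemma affine_form_coordinate: "i < k \<Longrightarrow> affine_form k (\<lambda>z. z i)"
  unfolding affine_form_def
  by (rule exI[of _ 0], rule exI[of _ "\<lambda>j. if j = i then 1 else 0"]) (simp add: if_distrib[of "\<lambda>x. x * _"] cong: if_cong)

lemma affine_form_mult: "affine_form k f \<Longrightarrow> affine_form k (\<lambda>z. b * f z)"
  unfolding affine_form_def
proof (elim exE)
  fix c a assume "\<forall>z. f z = c + (\<Sum>j<k. a j * z j)"
  then have "\<forall>z. b * f z = b * c + (\<Sum>j<k. (b * a j) * z j)"
    by (simp add: sum_distrib_left algebra_simps)
  then show "\<exists>c a. \<forall>z. b * f z = c + (\<Sum>j<k. a j * z j)"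
    by (intro exI[of _ "b * c"] exI[of _ "\<lambda>j. b * a j"])
qed

lemma affine_form_add:
  assumes "affine_form k f" "affine_form k g"
  shows "affine_form k (\<lambda>z. f z + g z)"
proof -
  obtain c a where f: "\<And>z. f z = c + (\<Sum>j<k. a j * z j)"
    using assms(1) unfolding affine_form_def by blast
  obtain d b where g: "\<And>z. g z = d + (\<Sum>j<k. b j * z j)"
    using assms(2) unfolding affine_form_def by blast
  have "f z + g z = (c + d) + (\<Sum>j<k. (a j + b j) * z j)" for z
    by (simp add: f g sum.distrib algebra_simps)
  then show ?thesis
    unfolding affine_form_def by (intro exI[of _ "c + d"] exI[of _ "\<lambda>j. a j + b j"] allI)
qed

lemma affine_form_sum:
  assumes "\<And>i. i \<in> S \<Longrightarrow> affine_form k (f i)"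
  shows "affine_form k (\<lambda>z. \<Sum>i\<in>S. f i z)"
  using assms
  by (induction S rule: infinite_finite_induct)
    (auto intro: affine_form_const affine_form_add)

lemma affine_forms_eq_coordinates_up_to_sign:
  assumes "\<And>i. i < k \<Longrightarrow> affine_form k (f i)"
  shows "\<exists>z. \<forall>i<k. (f i z)\<^sup>2 = (z i)\<^sup>2"
proof -
  obtain c A where "\<And>i z. i < k \<Longrightarrow> f i z = c i + (\<Sum>j<k. A i j * z j)"
    using assms unfolding affine_form_def by metis
  then show ?thesis using affine_system_up_to_sign[of k c A] by auto
qed

lemma sum_in_blocks_of_four:
  "(\<Sum>j<4 * m. f j) = (\<Sum>k<m. f (4 * k) + f (4 * k + 1) + f (4 * k + 2) + f (4 * k + 3))"
  for f :: "nat \<Rightarrow> 'a :: comm_monoid_add"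
  by (induction m) (simp_all add: eval_nat_numeral algebra_simps)

text \<open>After expansion the coefficient of \<open>x j * x j'\<close> is the inner product of
  columns \<open>j\<close> and \<open>j'\<close>.\<close>

lemma sum_squares_orthogonal_columns:
  fixes M :: "nat \<Rightarrow> nat \<Rightarrow> 'a :: comm_ring_1"
  assumes "\<And>j j'. j < n \<Longrightarrow> j' < n \<Longrightarrow> (\<Sum>i<n. M i j * M i j') = (if j = j' then r else 0)"
  shows "(\<Sum>i<n. (\<Sum>j<n. M i j * x j)\<^sup>2) = r * (\<Sum>j<n. (x j)\<^sup>2)"
proof -
  have "(\<Sum>i<n. (\<Sum>j<n. M i j * x j)\<^sup>2) = (\<Sum>i<n. \<Sum>j<n. \<Sum>j'<n. x j * x j' * (M i j * M i j'))"
    by (simp add: power2_eq_square sum_product algebra_simps)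
  also have "\<dots> = (\<Sum>j<n. \<Sum>i<n. \<Sum>j'<n. x j * x j' * (M i j * M i j'))"
    by (rule sum.swap)
  also have "\<dots> = (\<Sum>j<n. \<Sum>j'<n. \<Sum>i<n. x j * x j' * (M i j * M i j'))"
    by (intro sum.cong refl sum.swap)
  also have "\<dots> = (\<Sum>j<n. \<Sum>j'<n. x j * x j' * (\<Sum>i<n. M i j * M i j'))"
    by (simp add: sum_distrib_left)
  also have "\<dots> = (\<Sum>j<n. \<Sum>j'<n. if j' = j then r * (x j)\<^sup>2 else 0)"
    by (intro sum.cong refl) (simp add: assms power2_eq_square)
  also have "\<dots> = r * (\<Sum>j<n. (x j)\<^sup>2)"
    by (simp add: sum_distrib_left)
  finally show ?thesis .
qed

lemma orthogonal_columns_imp_sum_two_rat_squares: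
  fixes M :: "nat \<Rightarrow> nat \<Rightarrow> rat"
  assumes orth: "\<And>j j'. j < 4 * m + 2 \<Longrightarrow> j' < 4 * m + 2 \<Longrightarrow>
      (\<Sum>i<4 * m + 2. M i j * M i j') = (if j = j' then r else 0)"
    and r: "r = p\<^sup>2 + q\<^sup>2 + s\<^sup>2 + t\<^sup>2" "r \<noteq> 0"
  shows "\<exists>a b. r = a\<^sup>2 + b\<^sup>2"
proof -
  \<comment> \<open>\<open>H\<close> is, up to signs, the matrix of a quaternion of norm \<open>r\<close>; hence \<open>H * H\<^sup>T = r\<close>.\<close>
  define H where "H i = [[p, q, s, t], [q, - p, t, - s], [s, - t, - p, q], [t, s, - q, - p]] ! i"
    for i :: nat
  \<comment> \<open>On each block of four, \<open>X\<close> is \<open>1 / r\<close> times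
    \<open>H\<close> applied to \<open>z\<close>, so \<open>r\<close> times its sum of squares is
    that of \<open>z\<close>. The last two coordinates are \<open>1\<close> and \<open>0\<close>,
    which contribute exactly \<open>r\<close>.\<close>
  define X where "X z j = (if j < 4 * m then 1 / r * (\<Sum>l<4. H (j mod 4) ! l * z (4 * (j div 4) + l))
     else if j = 4 * m then 1 else 0)" for z j
  define Y where "Y i z = (\<Sum>j<4 * m + 2. M i j * X z j)" for i z
  have sum4: "(\<Sum>l<4. f l) = f 0 + f 1 + f 2 + f 3" for f :: "nat \<Rightarrow> rat"
    by (simp add: eval_nat_numeral)
  have aff_X: "affine_form (4 * m) (\<lambda>z. X z j)" for j
  proof (cases "j < 4 * m")
    case True
    then have "j div 4 < m" by (simp add: less_mult_imp_div_less)
    then have "4 * (j div 4) + l < 4 * m" if "l < 4" for l using that by linarith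
    then show ?thesis using True unfolding X_def
      by (simp only: if_True)
        (intro affine_form_mult affine_form_sum affine_form_coordinate, simp)
  qed (simp add: X_def affine_form_const)
  have "affine_form (4 * m) (Y i)" for i
    unfolding Y_def[abs_def] by (intro affine_form_sum affine_form_mult aff_X)
  \<comment> \<open>For this \<open>z\<close> the first \<open>4 * m\<close> squares on the left
    cancel against those on the right; agreement up to sign is enough.\<close>
  then obtain z where z: "\<And>i. i < 4 * m \<Longrightarrow> (Y i z)\<^sup>2 = (z i)\<^sup>2"
    using affine_forms_eq_coordinates_up_to_sign[of "4 * m" Y] by blast
  have block: "r * ((X z (4 * k))\<^sup>2 + (X z (4 * k + 1))\<^sup>2 + (X z (4 * k + 2))\<^sup>2 + (X z (4 * k + 3))\<^sup>2) =
      (z (4 * k))\<^sup>2 + (z (4 * k + 1))\<^sup>2 + (z (4 * k + 2))\<^sup>2 + (z (4 * k + 3))\<^sup>2" if "k < m" for k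
  proof -
    define u0 u1 u2 u3 where u: "u0 = z (4 * k)" "u1 = z (4 * k + 1)" "u2 = z (4 * k + 2)" "u3 = z (4 * k + 3)"
    have "Suc (4 * k) div 4 = k" "Suc (4 * k) mod 4 = 1"
        "Suc (Suc (4 * k)) div 4 = k" "Suc (Suc (4 * k)) mod 4 = 2"
      by presburger+
    then have X: "X z (4 * k) = 1 / r * (p * u0 + q * u1 + s * u2 + t * u3)"
        "X z (4 * k + 1) = 1 / r * (q * u0 - p * u1 + t * u2 - s * u3)"
        "X z (4 * k + 2) = 1 / r * (s * u0 - t * u1 - p * u2 + q * u3)"
        "X z (4 * k + 3) = 1 / r * (t * u0 + s * u1 - q * u2 - p * u3)"
      using that by (simp_all add: X_def H_def u sum4)
    have "(p * u0 + q * u1 + s * u2 + t * u3)\<^sup>2 + (q * u0 - p * u1 + t * u2 - s * u3)\<^sup>2 +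
        (s * u0 - t * u1 - p * u2 + q * u3)\<^sup>2 + (t * u0 + s * u1 - q * u2 - p * u3)\<^sup>2 =
        r * (u0\<^sup>2 + u1\<^sup>2 + u2\<^sup>2 + u3\<^sup>2)"
      unfolding r(1) by (simp add: power2_eq_square algebra_simps)
    then have "r * ((1 / r)\<^sup>2 * ((p * u0 + q * u1 + s * u2 + t * u3)\<^sup>2 + (q * u0 - p * u1 + t * u2 - s * u3)\<^sup>2 +
        (s * u0 - t * u1 - p * u2 + q * u3)\<^sup>2 + (t * u0 + s * u1 - q * u2 - p * u3)\<^sup>2)) =
        u0\<^sup>2 + u1\<^sup>2 + u2\<^sup>2 + u3\<^sup>2"
      using r(2) by (simp add: power2_eq_square)
    then show ?thesis unfolding X u[symmetric] by (simp only: power_mult_distrib flip: distrib_left)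
  qed
  have "(\<Sum>i<4 * m. (Y i z)\<^sup>2) + (Y (4 * m) z)\<^sup>2 + (Y (4 * m + 1) z)\<^sup>2 = (\<Sum>i<4 * m + 2. (Y i z)\<^sup>2)"
    by (simp add: eval_nat_numeral)
  also have "\<dots> = r * (\<Sum>j<4 * m + 2. (X z j)\<^sup>2)"
    unfolding Y_def by (rule sum_squares_orthogonal_columns) (rule orth)
  also have "\<dots> = r * (\<Sum>j<4 * m. (X z j)\<^sup>2) + r"
    by (simp add: X_def algebra_simps)
  also have "r * (\<Sum>j<4 * m. (X z j)\<^sup>2) = (\<Sum>j<4 * m. (z j)\<^sup>2)"
    unfolding sum_in_blocks_of_four sum_distrib_left by (intro sum.cong refl block) simp
  also have "\<dots> = (\<Sum>i<4 * m. (Y i z)\<^sup>2)" using z by simp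
  finally have "r = (Y (4 * m) z)\<^sup>2 + (Y (4 * m + 1) z)\<^sup>2" by simp
  then show ?thesis by blast
qed

text \<open>Take determinants in \<open>M^T * M = r * I\<close>.\<close>

lemma orthogonal_columns_imp_det_square:
  fixes M :: "nat \<Rightarrow> nat \<Rightarrow> 'a :: idom"
  assumes "\<And>j j'. j < n \<Longrightarrow> j' < n \<Longrightarrow> (\<Sum>i<n. M i j * M i j') = (if j = j' then r else 0)"
  shows "(det (mat n n (\<lambda>(i, j). M i j)))\<^sup>2 = r ^ n"
proof -
  let ?A = "mat n n (\<lambda>(i, j). M i j)"
  have "transpose_mat ?A * ?A = r \<cdot>\<^sub>m 1\<^sub>m n"
    by (rule eq_matI) (simp_all add: scalar_prod_def atLeast0LessThan assms)
  then have "det (transpose_mat ?A) * det ?A = r ^ n"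
    by (simp add: det_mult[symmetric, of _ n] det_smult)
  then show ?thesis by (simp add: det_transpose[of _ n] power2_eq_square)
qed

text \<open>For \<open>n = 2 * k + 1\<close> the equation reads \<open>r * (r^k)^2 = d^2\<close>;
  hence \<open>r^k\<close> divides \<open>d\<close>, and for \<open>r > 0\<close> the quotient
  squares to \<open>r\<close>.\<close>

lemma square_of_odd_power_square:
  fixes r n :: nat and d :: int
  assumes "int r ^ n = d\<^sup>2" "odd n"
  shows "\<exists>k. r = k\<^sup>2"
proof (cases "r = 0")
  case False
  obtain k where k: "n = 2 * k + 1" using assms(2) by (elim oddE)
  define e where "e = nat \<bar>d\<bar>"
  have "int (r * (r ^ k)\<^sup>2) = int (e\<^sup>2)"
    using assms(1) by (simp add: k e_def power_mult mult.commute flip: power_mult)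
  then have e: "r * (r ^ k)\<^sup>2 = e\<^sup>2" by (simp only: of_nat_eq_iff)
  then have "(r ^ k)\<^sup>2 dvd e\<^sup>2" by (metis dvd_triv_right)
  then obtain f where "e = r ^ k * f" by (auto elim: dvdE)
  then have "r = f\<^sup>2" using e False by (simp add: power_mult_distrib)
  then show ?thesis ..
qed (auto intro: exI[of _ 0])

subsection \<open>Bipartite graphs with 0 or 2 common neighbours\<close>

text \<open>The unsigned graph alone. The assumptions are symmetric in \<open>U\<close> and
  \<open>W\<close>, so each result for one part transfers to the other by
  \<open>swap_parts\<close>.\<close>

locale regular_bipartite_02_graph =
  fixes U W :: "'a set" and E :: "'a rel" and r :: nat
  assumes finite_parts: "finite U" "finite W"
    and disjoint: "U \<inter> W = {}"
    and bipartite: "E \<subseteq> U \<times> W \<union> W \<times> U"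
    and sym_E: "sym E"
    and card_nbrs: "v \<in> U \<union> W \<Longrightarrow> card (E `` {v}) = r"
    and card_common: "\<lbrakk>u \<in> U \<union> W; v \<in> U \<union> W; u \<noteq> v\<rbrakk> \<Longrightarrow> card (E `` {u} \<inter> E `` {v}) \<in> {0, 2}"
begin

lemma swap_parts: "regular_bipartite_02_graph W U E r"
proof
  show "card (E `` {v}) = r" if "v \<in> W \<union> U" for v
    using that card_nbrs by blast
  show "card (E `` {u} \<inter> E `` {v}) \<in> {0, 2}" if "u \<in> W \<union> U" "v \<in> W \<union> U" "u \<noteq> v" for u v
    using that card_common[of u v] by blast
qed (use finite_parts disjoint bipartite sym_E in auto)

lemma E_commute: "(u, v) \<in> E \<longleftrightarrow> (v, u) \<in> E"
  using sym_E by (blast dest: symD)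

lemma nbrs_U: "u \<in> U \<Longrightarrow> E `` {u} \<subseteq> W"
  and nbrs_W: "w \<in> W \<Longrightarrow> E `` {w} \<subseteq> U"
  using bipartite disjoint by auto

lemma finite_nbrs: "finite (E `` {v})"
  by (rule finite_subset[of _ "U \<union> W"]) (use finite_parts bipartite in auto)

text \<open>Counting the edges from both sides gives \<open>r * card U = r * card W\<close>.\<close>

lemma card_parts_eq:
  assumes "r > 0"
  shows "card U = card W"
proof -
  have "(\<Sum>u\<in>U. card {w \<in> W. (u, w) \<in> E}) = r * card W"
  proof (rule sum_multicount)
    show "\<forall>w\<in>W. card {u \<in> U. (u, w) \<in> E} = r"
    proof
      fix w assume w: "w \<in> W"
      then have "{u \<in> U. (u, w) \<in> E} = E `` {w}" using nbrs_W E_commute by auto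
      then show "card {u \<in> U. (u, w) \<in> E} = r" using w card_nbrs by simp
    qed
  qed (use finite_parts in auto)
  moreover have "card {w \<in> W. (u, w) \<in> E} = r" if "u \<in> U" for u
  proof -
    have "{w \<in> W. (u, w) \<in> E} = E `` {u}" using nbrs_U that by auto
    then show ?thesis using that card_nbrs by simp
  qed
  ultimately show ?thesis using assms by simp
qed

lemma finite_card_2_common:
  assumes "u \<in> U" "v \<in> U" "u \<noteq> v" "E `` {u} \<inter> E `` {v} \<noteq> {}"
  shows "card (E `` {u} \<inter> E `` {v}) = 2"
  using card_common[of u v] assms finite_nbrs by auto

text \<open>For \<open>u\<close> in \<open>U\<close> these are the vertices at distance two from
  \<open>u\<close>.\<close>

definition partners :: "'a \<Rightarrow> 'a set" where
  "partners u = {x \<in> U - {u}. E `` {u} \<inter> E `` {x} \<noteq> {}}"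

lemma card_common_partners:
  assumes "u \<in> U" "x \<in> partners u"
  shows "card (E `` {u} \<inter> E `` {x}) = 2"
  using assms finite_card_2_common[of u x] unfolding partners_def by blast

text \<open>
  Any two neighbours of \<open>u\<close> have exactly one common neighbour \<open>x\<close> besides \<open>u\<close>, and they are then the
  common neighbours of \<open>u\<close> and \<open>x\<close>.
\<close>

lemma card_partners:
  assumes u: "u \<in> U"
  shows "card (partners u) = r choose 2"
proof -
  interpret dual: regular_bipartite_02_graph W U E r by (rule swap_parts)
  let ?c = "\<lambda>x. E `` {u} \<inter> E `` {x}"
  have pair: "\<exists>x. x \<noteq> u \<and> E `` {v} \<inter> E `` {w} = {u, x}"
    if vw: "v \<in> E `` {u}" "w \<in> E `` {u}" "v \<noteq> w" for v w
  proof -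
    have "v \<in> W" "w \<in> W" using nbrs_U[OF u] vw by auto
    moreover have mem: "u \<in> E `` {v} \<inter> E `` {w}" using vw E_commute by auto
    ultimately have "card (E `` {v} \<inter> E `` {w}) = 2"
      using dual.finite_card_2_common[of v w] vw by blast
    then obtain a b where ab: "E `` {v} \<inter> E `` {w} = {a, b}" "a \<noteq> b" by (auto simp: card_2_iff)
    then have "u = a \<or> u = b" using mem by blast
    then show ?thesis using ab by (metis insert_commute)
  qed
  have "bij_betw ?c (partners u) {K. K \<subseteq> E `` {u} \<and> card K = 2}"
    unfolding bij_betw_def
  proof
    show "inj_on ?c (partners u)"
    proof (rule inj_onI)
      fix x y assume x: "x \<in> partners u" and y: "y \<in> partners u" and eq: "?c x = ?c y"
      have "card (?c x) = 2" using u x by (rule card_common_partners)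
      then obtain v w where vw: "?c x = {v, w}" "v \<noteq> w" by (auto simp: card_2_iff)
      \<comment> \<open>Both \<open>x\<close> and \<open>y\<close> differ from \<open>u\<close>, so
        each must be the other common neighbour \<open>z\<close> of \<open>v\<close> and
        \<open>w\<close>.\<close>
      then obtain z where "E `` {v} \<inter> E `` {w} = {u, z}" using pair[of v w] by blast
      moreover have "x \<in> E `` {v} \<inter> E `` {w}" "y \<in> E `` {v} \<inter> E `` {w}"
        using vw eq E_commute by blast+
      ultimately show "x = y" using x y by (auto simp: partners_def)
    qed
    show "?c ` partners u = {K. K \<subseteq> E `` {u} \<and> card K = 2}"
    proof
      show "?c ` partners u \<subseteq> {K. K \<subseteq> E `` {u} \<and> card K = 2}"
        using u card_common_partners by auto
      show "{K. K \<subseteq> E `` {u} \<and> card K = 2} \<subseteq> ?c ` partners u"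
      proof
        fix K assume K: "K \<in> {K. K \<subseteq> E `` {u} \<and> card K = 2}"
        then obtain v w where vw: "K = {v, w}" "v \<noteq> w" by (auto simp: card_2_iff)
        then obtain x where x: "x \<noteq> u" "E `` {v} \<inter> E `` {w} = {u, x}"
          using pair[of v w] K by blast
        then have sub: "K \<subseteq> ?c x" using vw K E_commute by blast
        have "v \<in> W" using K vw nbrs_U[OF u] by auto
        then have "x \<in> U" using x nbrs_W by blast
        then have p: "x \<in> partners u" using x sub vw by (auto simp: partners_def)
        then have "card (?c x) = card K"
          using K u card_common_partners by simp
        then have "K = ?c x" using sub finite_nbrs by (intro card_subset_eq) auto
        then show "K \<in> ?c ` partners u" using p by blast
      qed
    qed
  qed
  then have "card (partners u) = card {K. K \<subseteq> E `` {u} \<and> card K = 2}"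
    by (rule bij_betw_same_card)
  then show ?thesis using n_subsets[OF finite_nbrs, of u 2] card_nbrs u by simp
qed

text \<open>\<open>U\<close> contains the partners of \<open>u\<close> and also \<open>u\<close>
  itself.\<close>

lemma card_part_ge:
  assumes "u \<in> U"
  shows "card U \<ge> (r choose 2) + 1"
proof -
  have "card (partners u) \<le> card (U - {u})"
    using finite_parts by (intro card_mono) (auto simp: partners_def)
  then show ?thesis
    using card_partners[OF assms] card_Suc_Diff1[OF finite_parts(1) assms] by simp
qed

text \<open>Equality leaves no room outside \<open>partners p\<close>, so any two points of
  \<open>U\<close> have two common neighbours. The blocks are the neighbourhoods of the vertices of
  \<open>W\<close>.\<close>

lemma extremal_imp_symmetric_BIBD:
  assumes r: "r > 0" and card: "card U = (r choose 2) + 1"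
  shows "symmetric_BIBD U W (\<lambda>b. E `` {b}) (card U) r 2"
proof -
  have common: "card (E `` {p} \<inter> E `` {q}) = 2" if "p \<in> U" "q \<in> U" "p \<noteq> q" for p q
  proof -
    have "partners p = U - {p}"
      using finite_parts card card_partners[OF that(1)] that(1)
      by (intro card_subset_eq) (auto simp: partners_def)
    then have "q \<in> partners p" using that by blast
    then show ?thesis using that(1) by (intro card_common_partners)
  qed
  have "{b \<in> W. p \<in> E `` {b}} = E `` {p}" if "p \<in> U" for p
    using nbrs_U[OF that] E_commute by auto
  moreover have "{b \<in> W. p \<in> E `` {b} \<and> q \<in> E `` {b}} = E `` {p} \<inter> E `` {q}" if "p \<in> U" for p q
    using nbrs_U[OF that] E_commute by auto
  ultimately show ?thesis
    unfolding symmetric_BIBD_def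
    using finite_parts card_parts_eq[OF r] nbrs_W card_nbrs common by simp
qed

end

text \<open>The isomorphism tags each vertex with its part; a vertex of \<open>W\<close> serves as
  the index of the block formed by its neighbours.\<close>

lemma bipartite_digraph_iso_incidence_graph:
  fixes G :: "'a pair_pre_digraph"
  assumes wf: "wf_digraph (with_proj G)" and V: "pverts G = U \<union> W" and disj: "U \<inter> W = {}"
    and arcs: "parcs G \<subseteq> U \<times> W \<union> W \<times> U" and sym: "sym (parcs G)"
  shows "digraph_iso (with_proj G) (with_proj (incidence_graph U W (\<lambda>b. parcs G `` {b})))"
proof -
  define h :: "'a \<Rightarrow> 'a + 'a" where "h v = (if v \<in> U then Inl v else Inr v)" for v
  define f where "f = \<lparr> iso_verts = h, iso_arcs = map_prod h h, iso_head = snd, iso_tail = fst \<rparr>"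
  have inj: "inj h" by (rule injI) (simp add: h_def split: if_splits)
  have h: "v \<in> U \<Longrightarrow> h v = Inl v" "v \<in> W \<Longrightarrow> h v = Inr v" for v
    using disj by (auto simp: h_def)
  have s: "(u, v) \<in> parcs G \<longleftrightarrow> (v, u) \<in> parcs G" for u v using sym by (blast dest: symD)
  have "pre_digraph.digraph_isomorphism (with_proj G) f"
    unfolding pre_digraph.digraph_isomorphism_def f_def
    using wf inj prod.inj_map[OF inj inj] by (auto intro: inj_on_subset)
  moreover have "h ` pverts G = Inl ` U \<union> Inr ` W"
    unfolding V image_Un by (simp add: h cong: image_cong)
  moreover have "map_prod h h ` parcs G =
      {(Inl p, Inr b) | p b. p \<in> U \<and> b \<in> W \<and> p \<in> parcs G `` {b}} \<union>
      {(Inr b, Inl p) | p b. p \<in> U \<and> b \<in> W \<and> p \<in> parcs G `` {b}}" (is "?L = ?R")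
  proof
    show "?L \<subseteq> ?R"
    proof
      fix e assume "e \<in> ?L"
      then obtain u v where e: "e = (h u, h v)" "(u, v) \<in> parcs G" by auto
      then consider "u \<in> U" "v \<in> W" | "u \<in> W" "v \<in> U" using arcs by blast
      then show "e \<in> ?R" by cases (use e h s in auto)
    qed
    show "?R \<subseteq> ?L"
    proof
      fix e assume "e \<in> ?R"
      then obtain p b where pb: "p \<in> U" "b \<in> W" "(b, p) \<in> parcs G"
        and e: "e = (Inl p, Inr b) \<or> e = (Inr b, Inl p)" by blast
      have "map_prod h h (p, b) \<in> ?L" "map_prod h h (b, p) \<in> ?L"
        using pb s by (intro imageI; simp)+
      moreover have "e = map_prod h h (p, b) \<or> e = map_prod h h (b, p)"
        using e pb h by simp
      ultimately show "e \<in> ?L" by metis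
    qed
  qed
  ultimately have "with_proj (incidence_graph U W (\<lambda>b. parcs G `` {b})) = app_iso f (with_proj G)"
    by (simp only: app_iso_def with_proj_def incidence_graph_def f_def pair_pre_digraph.simps
        digraph_isomorphism.simps pre_digraph.simps)
  then show ?thesis unfolding digraph_iso_def using \<open>pre_digraph.digraph_isomorphism (with_proj G) f\<close> by blast
qed

subsection \<open>Signed rectagraphs with two symmetric eigenvalues\<close>

lemma out_degree_with_proj: "out_degree (with_proj G) v = card (parcs G `` {v})"
proof -
  have "out_arcs (with_proj G) v = Pair v ` (parcs G `` {v})"
    by (auto simp: out_arcs_def)
  then show ?thesis by (simp add: out_degree_def card_image inj_on_def)
qed

lemma SR2SE_signed_rows_orthogonal:
  fixes G :: "'a pair_pre_digraph" and \<sigma> :: "'a set \<Rightarrow> int"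
  assumes S: "SR2SE_params N r G \<sigma>"
  defines "a \<equiv> \<lambda>u v. if (u, v) \<in> parcs G then \<sigma> {u, v} else 0"
  shows "r > 0"
    and "\<And>u v. u \<in> pverts G \<Longrightarrow> v \<in> pverts G \<Longrightarrow>
      (\<Sum>w\<in>pverts G. a u w * a v w) = (if u = v then int r else 0)"
proof -
  let ?V = "pverts G"
  have graph: "pair_graph G" and sgn: "\<And>u v. (u, v) \<in> parcs G \<Longrightarrow> \<sigma> {u, v} \<in> {1, - 1}"
    and reg: "\<And>v. v \<in> ?V \<Longrightarrow> out_degree (with_proj G) v = r"
    and conn: "Digraph_Component.connected (with_proj G)"
    using S by (auto simp: SR2SE_params_def SR2SE_def signed_rectagraph_def signed_02_graph_def
        signed_graph_def regular_graph_def)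
  interpret pair_graph G by (rule graph)
  obtain \<mu> where mu: "\<mu> \<noteq> - \<mu>" "signed_spectrum G \<sigma> = {\<mu>, - \<mu>}"
    using S by (auto simp: SR2SE_params_def SR2SE_def)
  obtain vs where vs: "set vs = ?V" "distinct vs"
    using finite_distinct_list[OF pair_finite_verts] by blast
  define n where "n = length vs"
  have a_commute: "a u v = a v u" for u v
    using pair_sym_arcs unfolding a_def symmetric_def by (auto simp: insert_commute dest: symD)
  define A where "A = signed_adj_mat G \<sigma> vs"
  have A: "A \<in> carrier_mat n n" by (simp add: A_def signed_adj_mat_def n_def)
  have A_nth: "A $$ (i, j) = of_int (a (vs ! i) (vs ! j))" if "i < n" "j < n" for i j
    using that by (simp add: A_def signed_adj_mat_def n_def a_def)
  have "A * A = \<mu>\<^sup>2 \<cdot>\<^sub>m 1\<^sub>m n"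
  proof (rule real_symmetric_eigenvalues_imp_square[OF A])
    show "A $$ (i, j) = A $$ (j, i)" if "i < n" "j < n" for i j
      using that by (simp add: A_nth a_commute)
    show "k\<^sup>2 = \<mu>\<^sup>2" if "eigenvalue A k" for k
      using that mu(2) unfolding signed_spectrum_eq[OF vs(2,1)] A_def[symmetric] spectrum_def
      by (auto simp: power2_eq_iff)
  qed
  then have sq: "(\<Sum>w\<in>?V. real_of_int (a u w * a v w)) = (if u = v then \<mu>\<^sup>2 else 0)"
    if uv: "u \<in> ?V" "v \<in> ?V" for u v
  proof -
    obtain i j where ij: "i < n" "j < n" "u = vs ! i" "v = vs ! j"
      using uv unfolding vs(1)[symmetric] in_set_conv_nth n_def by blast
    have "(\<Sum>w\<in>?V. real_of_int (a u w * a v w)) = (\<Sum>l<n. of_int (a u (vs ! l) * a v (vs ! l)))"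
      using sum.reindex_bij_betw[OF bij_betw_nth[OF vs(2) refl vs(1)[symmetric]],
          of "\<lambda>w. real_of_int (a u w * a v w)"] by (simp add: n_def)
    \<comment> \<open>Symmetry of \<open>a\<close> turns the inner product of two rows into an entry
      of the matrix square.\<close>
    also have "\<dots> = (A * A) $$ (i, j)"
      using ij A by (simp add: scalar_prod_def atLeast0LessThan A_nth a_commute[of "vs ! j"])
    also have "\<dots> = (if u = v then \<mu>\<^sup>2 else 0)"
      unfolding \<open>A * A = _\<close> using ij vs(2) by (simp add: nth_eq_iff_index_eq n_def)
    finally show ?thesis .
  qed
  have diag: "(\<Sum>w\<in>?V. a u w * a u w) = int r" if "u \<in> ?V" for u
  proof -
    have "(\<Sum>w\<in>?V. a u w * a u w) = (\<Sum>w\<in>?V. if w \<in> parcs G `` {u} then 1 else 0)"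
    proof (intro sum.cong refl)
      show "a u w * a u w = (if w \<in> parcs G `` {u} then 1 else 0)" for w
        using sgn[of u w] by (auto simp: a_def)
    qed
    also have "\<dots> = (\<Sum>w\<in>?V \<inter> parcs G `` {u}. 1)"
      by (rule sum.inter_restrict[OF pair_finite_verts, symmetric])
    also have "\<dots> = int (card (?V \<inter> parcs G `` {u}))" by simp
    also have "?V \<inter> parcs G `` {u} = parcs G `` {u}"
      using in_arcsD2 by auto
    also have "card (parcs G `` {u}) = r"
      using reg[OF that] by (simp add: out_degree_with_proj)
    finally show ?thesis .
  qed
  \<comment> \<open>Connectedness supplies a vertex at which the degree is compared with the squared
    eigenvalue; the latter is nonzero since \<open>\<mu> \<noteq> - \<mu>\<close>, so
    \<open>r > 0\<close>.\<close>
  obtain u0 where u0: "u0 \<in> ?V" using conn by (auto simp: connected_def strongly_connected_def)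
  have "real_of_int (int r) = \<mu>\<^sup>2"
    unfolding diag[OF u0, symmetric] using sq[OF u0 u0] by simp
  then show "r > 0" using mu(1) by (cases r) auto
  show "(\<Sum>w\<in>?V. a u w * a v w) = (if u = v then int r else 0)" if "u \<in> ?V" "v \<in> ?V" for u v
  proof (cases "u = v")
    case False
    then have "real_of_int (\<Sum>w\<in>?V. a u w * a v w) = 0" using sq[OF that] by simp
    then show ?thesis using False by (simp only: of_int_eq_0_iff if_False)
  qed (use diag that in simp)
qed

text \<open>With \<open>d = n - r\<close> the claim is \<open>r \<le> d^2 + 1\<close>. For
  \<open>r \<ge> 4\<close> the hypothesis yields \<open>2 * d \<ge> r\<close> and
  \<open>d \<ge> 2\<close>, so \<open>d^2 \<ge> 2 * d \<ge> r\<close>. For smaller \<open>r\<close>,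
  oddness excludes the failing pairs \<open>n = 2\<close>, \<open>r = 2\<close> and
  \<open>n = 4\<close>, \<open>r = 3\<close>.\<close>

lemma quadratic_bound_of_choose_two_bound:
  fixes n r :: nat
  assumes n: "n \<ge> (r choose 2) + 1" and odd: "odd n"
  shows "int n \<le> (int n - int r)\<^sup>2 + int n - int r + 1"
proof (cases "r \<le> 3")
  case True
  then consider "r = 0" | "r = 1" | "r = 2" | "r = 3" by linarith
  then show ?thesis
  proof cases
    case 3
    then have "n \<ge> 3" using n odd by (cases "n = 2") auto
    then show ?thesis using 3 self_le_power[of "int n - 2" 2] by simp
  next
    case 4
    then have "n \<ge> 4" using n by (simp add: choose_two)
    moreover have "n \<noteq> 4" using odd by auto
    ultimately have "n \<ge> 5" by linarith
    then have "(2 :: int)\<^sup>2 \<le> (int n - 3)\<^sup>2" by (intro power_mono) auto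
    then show ?thesis using 4 by simp
  qed auto
next
  case False
  have "even (r * (r - 1))" by (cases r) auto
  then have "2 * (r choose 2) = r * (r - 1)" by (simp add: choose_two)
  then have "int (2 * (r choose 2)) = int (r * (r - 1))" by (simp only:)
  then have "2 * int (r choose 2) = int r * (int r - 1)" using False by (simp add: of_nat_diff)
  then have "2 * (int n - int r) \<ge> int r * (int r - 3) + 2" using n by (simp add: algebra_simps)
  moreover have "int r * (int r - 3) \<ge> int r * 1" using False by (intro mult_left_mono) auto
  moreover define d where "d = int n - int r"
  ultimately have d: "2 * d \<ge> int r" by simp
  then have "d \<ge> 2" using False by linarith
  then have "2 * d \<le> d * d" by (intro mult_right_mono) auto
  then have "int r \<le> d\<^sup>2 + 1" using d unfolding power2_eq_square by linarith
  then show ?thesis unfolding d_def by linarith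
qed

text \<open>An even square is divisible by 4, and an odd square is 1 modulo 4. Applied to
  \<open>r = k^2\<close>, this is the congruence for odd \<open>n\<close>.\<close>

lemma four_dvd_square_mult_pred:
  fixes k :: int
  shows "[k\<^sup>2 * (k\<^sup>2 - 1) = 0] (mod 4)"
proof (cases "even k")
  case True
  then show ?thesis by (auto simp: cong_0_iff power_mult_distrib elim!: evenE)
next
  case False
  then obtain j where "k = 2 * j + 1" by (elim oddE)
  then have "k\<^sup>2 * (k\<^sup>2 - 1) = 4 * (k\<^sup>2 * (j\<^sup>2 + j))" by (simp add: power2_eq_square algebra_simps)
  then show ?thesis unfolding cong_0_iff by (rule dvdI)
qed

theorem theorem3p6:
  fixes G :: "'a pair_pre_digraph" and \<sigma> :: "'a set \<Rightarrow> int" and n r :: nat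
  assumes "SR2SE_params (2 * n) r G \<sigma>" and "bipartite_graph G"
  shows
    "n \<ge> (r choose 2) + 1 \<and>
     (n = (r choose 2) + 1 \<longrightarrow>
        (\<exists>(P :: 'a set) (B :: 'a set) blk. symmetric_BIBD P B blk n r 2 \<and>
           digraph_iso (with_proj G) (with_proj (incidence_graph P B blk)))) \<and>
     (odd n \<longrightarrow>
        (\<exists>k :: nat. r = k ^ 2) \<and>
        int n \<le> (int n - int r) ^ 2 + int n - int r + 1 \<and>
        [int r * (int r - 1) = 0] (mod 4)) \<and>
     ([n = 2] (mod 4) \<longrightarrow> (\<exists>a b :: int. int r = a ^ 2 + b ^ 2))"
proof -
  define a where "a u v = (if (u, v) \<in> parcs G then \<sigma> {u, v} else 0)" for u v
  note SR2SE_signed_rows_orthogonal[OF assms(1), folded a_def]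
  then have r: "r > 0"
    and rows: "\<And>u v. u \<in> pverts G \<Longrightarrow> v \<in> pverts G \<Longrightarrow>
      (\<Sum>w\<in>pverts G. a u w * a v w) = (if u = v then int r else 0)" by blast+
  have graph: "pair_graph G" and reg: "\<And>v. v \<in> pverts G \<Longrightarrow> out_degree (with_proj G) v = r"
    and card_V: "card (pverts G) = 2 * n"
    and conn: "Digraph_Component.connected (with_proj G)"
    and cn: "\<And>u v. \<lbrakk>u \<in> pverts G; v \<in> pverts G; u \<noteq> v\<rbrakk> \<Longrightarrow> card (common_neighbours G u v) \<in> {0, 2}"
    using assms(1) by (auto simp: SR2SE_params_def SR2SE_def signed_rectagraph_def signed_02_graph_def
        signed_graph_def regular_graph_def)
  interpret pair_graph G by (rule graph)
  obtain U W where V: "pverts G = U \<union> W" and disj: "U \<inter> W = {}"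
    and bip: "parcs G \<subseteq> U \<times> W \<union> W \<times> U"
    using assms(2) unfolding bipartite_graph_def by blast
  have sym: "sym (parcs G)" using pair_sym_arcs unfolding symmetric_def by simp
  interpret bg: regular_bipartite_02_graph U W "parcs G" r
  proof
    show "finite U" "finite W" using pair_finite_verts V by auto
    show "card (parcs G `` {v}) = r" if "v \<in> U \<union> W" for v
      using reg[of v] that V by (simp add: out_degree_with_proj)
    show "card (parcs G `` {u} \<inter> parcs G `` {v}) \<in> {0, 2}"
      if "u \<in> U \<union> W" "v \<in> U \<union> W" "u \<noteq> v" for u v
    proof -
      have "common_neighbours G u v = parcs G `` {u} \<inter> parcs G `` {v}"
        using in_arcsD2 by (auto simp: common_neighbours_def)
      then show ?thesis using cn that V by metis
    qed
  qed (use disj bip sym in auto)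
  have card_U: "card U = n" and card_W: "card W = n"
    using bg.card_parts_eq[OF r] card_V card_Un_disjoint[OF bg.finite_parts disj] V by auto
  have "pverts G \<noteq> {}" using conn by (auto simp: connected_def strongly_connected_def)
  \<comment> \<open>The parts have equal size, so neither is empty; the counting bound needs a
    vertex of \<open>U\<close>.\<close>
  then have "U \<noteq> {}" using card_V V card_U card_W bg.finite_parts by auto
  then have bound: "n \<ge> (r choose 2) + 1" using bg.card_part_ge card_U by auto
  have BIBD: "\<exists>(P :: 'a set) (B :: 'a set) blk. symmetric_BIBD P B blk n r 2 \<and>
      digraph_iso (with_proj G) (with_proj (incidence_graph P B blk))" if "n = (r choose 2) + 1"
  proof (intro exI conjI)
    show "symmetric_BIBD U W (\<lambda>b. parcs G `` {b}) n r 2"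
      using bg.extremal_imp_symmetric_BIBD[OF r] that card_U by simp
    show "digraph_iso (with_proj G) (with_proj (incidence_graph U W (\<lambda>b. parcs G `` {b})))"
      by (rule bipartite_digraph_iso_incidence_graph[OF wf_digraph_axioms V disj bip sym])
  qed
  obtain f g where f: "bij_betw f {..<n} W" and g: "bij_betw g {..<n} U"
    using card_U card_W bg.finite_parts
    by (metis atLeast0LessThan ex_bij_betw_nat_finite)
  \<comment> \<open>Columns are indexed by \<open>U\<close> and rows by \<open>W\<close>, so
    orthogonality of the adjacency rows at vertices of \<open>U\<close> becomes orthogonality of the
    columns of \<open>M\<close>.\<close>
  define M where "M i j = a (g j) (f i)" for i j
  have orth: "(\<Sum>i<n. M i j * M i j') = (if j = j' then int r else 0)" if "j < n" "j' < n" for j j'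
  proof -
    have gU: "g j \<in> U" "g j' \<in> U" using g that by (auto simp: bij_betw_def)
    have "(\<Sum>i<n. M i j * M i j') = (\<Sum>w\<in>W. a (g j) w * a (g j') w)"
      unfolding M_def using sum.reindex_bij_betw[OF f] by fast
    \<comment> \<open>Vertices of \<open>U\<close> have all their neighbours in \<open>W\<close>, so
      the added terms vanish.\<close>
    also have "\<dots> = (\<Sum>w\<in>pverts G. a (g j) w * a (g j') w)"
      using gU bip disj V pair_finite_verts by (intro sum.mono_neutral_left) (auto simp: a_def)
    also have "\<dots> = (if g j = g j' then int r else 0)"
      using gU V by (intro rows) auto
    also have "g j = g j' \<longleftrightarrow> j = j'"
      using g that by (auto simp: bij_betw_def inj_on_def)
    finally show ?thesis .
  qed
  have square: "\<exists>k. r = k\<^sup>2" if "odd n"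
    using square_of_odd_power_square[OF orthogonal_columns_imp_det_square[OF orth, symmetric] that] .
  have "\<exists>a b :: int. int r = a\<^sup>2 + b\<^sup>2" if "[n = 2] (mod 4)"
  proof -
    have "n mod 4 = 2" using that by (simp add: cong_def)
    then have n: "n = 4 * (n div 4) + 2" by presburger
    obtain p q s t :: rat where four: "of_nat r = p\<^sup>2 + q\<^sup>2 + s\<^sup>2 + t\<^sup>2"
      using sum_four_rat_squares_of_nat[of r] unfolding sum_four_rat_squares_def by blast
    have "(\<Sum>i<4 * (n div 4) + 2. rat_of_int (M i j) * of_int (M i j')) = (if j = j' then of_nat r else 0)"
      if "j < 4 * (n div 4) + 2" "j' < 4 * (n div 4) + 2" for j j'
      using orth[of j j'] that unfolding n[symmetric]
      by (simp flip: of_int_mult of_int_sum)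
    from orthogonal_columns_imp_sum_two_rat_squares[OF this four] r
    obtain b c :: rat where "of_nat r = b\<^sup>2 + c\<^sup>2" by auto
    \<comment> \<open>The Davenport-Cassels descent replaces the rational squares by integer
      ones.\<close>
    then show ?thesis using sum_two_squares_rat_imp_int[of "int r" b c] by simp
  qed
  moreover have "[int r * (int r - 1) = 0] (mod 4)" if "odd n"
  proof -
    obtain k where "r = k\<^sup>2" using square[OF \<open>odd n\<close>] by blast
    then show ?thesis using four_dvd_square_mult_pred[of "int k"] by simp
  qed
  ultimately show ?thesis
    using bound BIBD square quadratic_bound_of_choose_two_bound[OF bound] by blast
qed

end
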